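(* Let $L_{\mathcal{P}}=\{u\in\{0,1\}^+\mid u=u^R\}$ be the set of nonempty binary palindromes. Then every graph is $L_{\mathcal{P}}$-representable, i.e., $\mathcal{G}_{L_{\mathcal{P}}}$ is the class of all graphs.
   Context: All graphs are finite, simple, undirected, with nonempty vertex sets, and graph classes are considered up to isomorphism. $u^R$ denotes the reversal of $u$, $\lambda$ the empty word. For an alphabet $V$ and distinct $u,v\in V$, $h_{u,v}:V^*\to\{0,1\}^*$ is the monoid morphism with $u\mapsto 0$, $v\mapsto 1$ and $x\mapsto\lambda$ for all other letters $x$. For a language $L\subseteq\{0,1\}^*$ closed under exchanging 0 and 1 and a nonempty word $w$ whose set of occurring letters is $V$, $G(L,w)$ is the graph with vertex set $V$ in which distinct $u,v$ are adjacent iff $h_{u,v}(w)\in L$. A graph is $L$-representable if it is isomorphic to some $G(L,w)$; $\mathcal{G}_L$ is the class of $L$-representable graphs. *)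

theory Defs
  imports "Graph_Theory.Graph_Theory"
begin

text \<open>
  Simple undirected graphs are the loop-free symmetric pair digraphs of the library
  (\<open>pair_graph\<close>, which includes finiteness); here they must also be nonempty.
  Isomorphism is \<open>digraph_iso\<close>: since arcs are pairs of vertices, it amounts to a bijection
  of the vertices that preserves and reflects adjacency (\<open>graph_isomorphic_iff\<close> below).
\<close>

definition simple_graph :: "'a pair_pre_digraph \<Rightarrow> bool" where
  "simple_graph G \<longleftrightarrow> pair_graph G \<and> pverts G \<noteq> {}"

definition graph_isomorphic :: "'a pair_pre_digraph \<Rightarrow> 'b pair_pre_digraph \<Rightarrow> bool" where
  "graph_isomorphic G H \<longleftrightarrow> digraph_iso (with_proj G) (with_proj H)"

lemma graph_isomorphic_iff:
  assumes "simple_graph G" and "simple_graph H"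
  shows "graph_isomorphic G H \<longleftrightarrow>
    (\<exists>f. bij_betw f (pverts G) (pverts H) \<and>
      (\<forall>u\<in>pverts G. \<forall>v\<in>pverts G. (u, v) \<in> parcs G \<longleftrightarrow> (f u, f v) \<in> parcs H))"
    (is "?L \<longleftrightarrow> (\<exists>f. ?R f)")
proof
  interpret G: pair_graph G using assms(1) by (simp add: simple_graph_def)
  interpret H: pair_graph H using assms(2) by (simp add: simple_graph_def)
  {
    assume ?L
    then obtain h where h: "pre_digraph.digraph_isomorphism (with_proj G) h"
      and H: "with_proj H = app_iso h (with_proj G)"
      by (auto simp: graph_isomorphic_def digraph_iso_def)
    let ?f = "iso_verts h"
    have verts: "pverts H = ?f ` pverts G" and arcs: "parcs H = iso_arcs h ` parcs G"
      and ends: "iso_tail h = fst" "iso_head h = snd"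
      using H by (auto simp: with_proj_def app_iso_def)
    have inj: "inj_on ?f (pverts G)"
      using h by (simp add: pre_digraph.digraph_isomorphism_def)
    have "iso_arcs h a = (?f (fst a), ?f (snd a))" if "a \<in> parcs G" for a
      using h that by (simp add: pre_digraph.digraph_isomorphism_def ends prod_eq_iff)
    then have arcs': "parcs H = (\<lambda>a. (?f (fst a), ?f (snd a))) ` parcs G"
      unfolding arcs by (intro image_cong) auto
    have "(u, v) \<in> parcs G \<longleftrightarrow> (?f u, ?f v) \<in> parcs H"
      if "u \<in> pverts G" "v \<in> pverts G" for u v
    proof
      show "(?f u, ?f v) \<in> parcs H" if "(u, v) \<in> parcs G"
        using imageI[OF that, of "\<lambda>a. (?f (fst a), ?f (snd a))"] by (simp add: arcs')
    next
      assume "(?f u, ?f v) \<in> parcs H"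
      then obtain a b where ab: "(a, b) \<in> parcs G" "?f u = ?f a" "?f v = ?f b"
        by (auto simp: arcs')
      have "u = a" "v = b"
        using inj_onD[OF inj ab(2) that(1)] inj_onD[OF inj ab(3) that(2)] G.wellformed'[OF ab(1)]
        by blast+
      then show "(u, v) \<in> parcs G" using ab by simp
    qed
    then have "?R ?f" using inj verts by (simp add: bij_betw_def)
    then show "\<exists>f. ?R f" by blast
  next
    assume "\<exists>f. ?R f"
    then obtain f where bij: "bij_betw f (pverts G) (pverts H)"
      and adj: "\<And>u v. u \<in> pverts G \<Longrightarrow> v \<in> pverts G \<Longrightarrow>
        (u, v) \<in> parcs G \<longleftrightarrow> (f u, f v) \<in> parcs H"
      by blast
    have inj: "inj_on f (pverts G)" and img: "f ` pverts G = pverts H"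
      using bij by (auto simp: bij_betw_def)
    let ?h = "\<lparr> iso_verts = f, iso_arcs = map_prod f f, iso_head = snd, iso_tail = fst \<rparr>"
    have sub: "parcs G \<subseteq> pverts G \<times> pverts G"
      by (rule subsetI) (auto simp: G.wellformed')
    have "inj_on (map_prod f f) (parcs G)"
      using map_prod_inj_on[OF inj inj] sub by (rule inj_on_subset)
    then have 1: "pre_digraph.digraph_isomorphism (with_proj G) ?h"
      using inj G.wf_digraph by (simp add: pre_digraph.digraph_isomorphism_def)
    have "parcs H = map_prod f f ` parcs G"
    proof (rule set_eqI, clarify)
      fix x y
      show "(x, y) \<in> parcs H \<longleftrightarrow> (x, y) \<in> map_prod f f ` parcs G"
      proof
        assume xy: "(x, y) \<in> parcs H"
        then obtain u v where uv: "u \<in> pverts G" "v \<in> pverts G" "x = f u" "y = f v"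
          using H.wellformed'[OF xy] img by blast
        then have "(u, v) \<in> parcs G" using xy adj by simp
        then show "(x, y) \<in> map_prod f f ` parcs G"
          using imageI[of "(u, v)" "parcs G" "map_prod f f"] uv by simp
      next
        assume "(x, y) \<in> map_prod f f ` parcs G"
        then obtain u v where uv: "(u, v) \<in> parcs G" "x = f u" "y = f v" by auto
        then show "(x, y) \<in> parcs H"
          using adj[OF G.wellformed'[OF uv(1)]] by simp
      qed
    qed
    then have "with_proj H = app_iso ?h (with_proj G)"
      using img by (simp add: with_proj_def app_iso_def)
    then show ?L
      using 1 by (auto simp: graph_isomorphic_def digraph_iso_def)
  }
qed

text \<open>Binary words have type \<open>bool list\<close>, with \<open>False\<close> for the letter 0 and \<open>True\<close> for 1.\<close>

definition proj_hom :: "'v \<Rightarrow> 'v \<Rightarrow> 'v list \<Rightarrow> bool list" where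
  "proj_hom u v w =
     concat (map (\<lambda>x. if x = u then [False] else if x = v then [True] else []) w)"

definition exchange_closed :: "bool list set \<Rightarrow> bool" where
  "exchange_closed L \<longleftrightarrow> (\<forall>x\<in>L. map Not x \<in> L)"

definition word_graph :: "bool list set \<Rightarrow> 'v list \<Rightarrow> 'v pair_pre_digraph" where
  "word_graph L w =
     \<lparr> pverts = set w,
       parcs = {(u, v). u \<in> set w \<and> v \<in> set w \<and> u \<noteq> v \<and> proj_hom u v w \<in> L} \<rparr>"

text \<open>
  The alphabet of a word is finite, so up to isomorphism of \<open>word_graph L w\<close> its letters may be
  taken to be natural numbers. The vertices of \<open>G\<close> may have any type.
\<close>

definition representable :: "bool list set \<Rightarrow> 'a pair_pre_digraph \<Rightarrow> bool" where
  "representable L G \<longleftrightarrow>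
     (\<exists>w :: nat list. w \<noteq> [] \<and> graph_isomorphic G (word_graph L w))"

definition represented_class :: "bool list set \<Rightarrow> 'a pair_pre_digraph set" where
  "represented_class L = {G. representable L G}"

definition palindromes :: "bool list set" where
  "palindromes = {u. u \<noteq> [] \<and> u = rev u}"

lemma proj_hom_swap: "u \<noteq> v \<Longrightarrow> proj_hom v u w = map Not (proj_hom u v w)"
  by (induction w) (auto simp: proj_hom_def)

text \<open>Closure under exchange makes adjacency symmetric, so \<open>word_graph L w\<close> is a graph.\<close>

lemma simple_graph_word_graph:
  assumes "exchange_closed L" and "w \<noteq> []"
  shows "simple_graph (word_graph L w)"
proof -
  have "pair_graph (word_graph L w)"
  proof (unfold_locales, goal_cases)
    case 6
    then show ?case
      using assms(1) proj_hom_swap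
      by (fastforce simp: word_graph_def symmetric_def sym_def arcs_ends_def arc_to_ends_def
          exchange_closed_def image_iff)
  qed (auto simp: word_graph_def intro: finite_subset[of _ "set w \<times> set w"])
  then show ?thesis
    using assms(2) by (simp add: simple_graph_def word_graph_def)
qed

lemma exchange_closed_palindromes: "exchange_closed palindromes"
  by (auto simp: exchange_closed_def palindromes_def rev_map)

end

(* Start from a palindrome containing all vertices and wrap it, once for each non-adjacent pair
   {u, v}, as u v w u v. A projection to any other pair sees at most one of u and v, so it is
   extended by the same palindrome on both sides, while the projection to {u, v} starts with u
   and ends with v and is never a palindrome again. *)

theory Submission
  imports Defs
begin

fun wrap_pairs :: "('v \<times> 'v) list \<Rightarrow> 'v list \<Rightarrow> 'v list" where
  "wrap_pairs [] w = w"
| "wrap_pairs ((u, v) # ps) w = [u, v] @ wrap_pairs ps w @ [u, v]"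

lemma set_wrap_pairs: "set (wrap_pairs ps w) = set w \<union> fst ` set ps \<union> snd ` set ps"
  by (induction ps w rule: wrap_pairs.induct) auto

lemma proj_hom_append: "proj_hom a b (xs @ ys) = proj_hom a b xs @ proj_hom a b ys"
  by (simp add: proj_hom_def)

lemma proj_hom_rev: "proj_hom a b (rev w) = rev (proj_hom a b w)"
  by (induction w) (auto simp: proj_hom_def)

lemma proj_hom_eq_Nil_iff: "proj_hom a b w = [] \<longleftrightarrow> a \<notin> set w \<and> b \<notin> set w"
  by (induction w) (auto simp: proj_hom_def)

text \<open>Injectivity on \<open>A\<close> preserves the outcome of every comparison with
  \<open>a\<close> or \<open>b\<close>. This allows vertices of any type to be renamed to the
  letters that representability requires.\<close>

lemma proj_hom_map:
  assumes "inj_on f A" and "set w \<subseteq> A" and "a \<in> A" and "b \<in> A"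
  shows "proj_hom (f a) (f b) (map f w) = proj_hom a b w"
proof -
  have "f x = f a \<longleftrightarrow> x = a" "f x = f b \<longleftrightarrow> x = b" if "x \<in> set w" for x
    using assms that by (auto dest: inj_onD)
  then show ?thesis
    by (auto simp: proj_hom_def intro!: arg_cong[where f = concat])
qed

text \<open>If the pairs coincide, \<open>[u, v]\<close> projects to 01 or 10, so the first and last
  letters of the result differ. Otherwise it projects to at most one letter, which is its own
  reversal, and adding it at both ends neither creates nor destroys a palindrome.\<close>

lemma rev_proj_hom_wrap_iff:
  assumes "a \<noteq> b" and "u \<noteq> v"
  shows "rev (proj_hom a b ([u, v] @ w @ [u, v])) = proj_hom a b ([u, v] @ w @ [u, v]) \<longleftrightarrow>
    {a, b} \<noteq> {u, v} \<and> rev (proj_hom a b w) = proj_hom a b w"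
proof (cases "{a, b} = {u, v}")
  case True
  then have "proj_hom a b [u, v] = [False, True] \<or> proj_hom a b [u, v] = [True, False]"
    using assms by (auto simp: proj_hom_def doubleton_eq_iff)
  then show ?thesis
    unfolding proj_hom_append using True by auto
next
  case False
  then have "proj_hom a b [u, v] = [] \<or> (\<exists>c. proj_hom a b [u, v] = [c])"
    using assms by (auto simp: proj_hom_def doubleton_eq_iff)
  then show ?thesis
    unfolding proj_hom_append using False by auto
qed

text \<open>Induction peels off one layer at a time down to the core \<open>w\<close>, whose
  projections are palindromes because \<open>w\<close> is one. Both orders of the pair appear
  because a layer acts on unordered pairs.\<close>

lemma rev_proj_hom_wrap_pairs_iff:
  assumes "a \<noteq> b" and "\<And>u v. (u, v) \<in> set ps \<Longrightarrow> u \<noteq> v" and "rev w = w"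
  shows "rev (proj_hom a b (wrap_pairs ps w)) = proj_hom a b (wrap_pairs ps w) \<longleftrightarrow>
    (a, b) \<notin> set ps \<and> (b, a) \<notin> set ps"
  using assms
proof (induction ps w rule: wrap_pairs.induct)
  case (1 w)
  then show ?case using proj_hom_rev[of a b w] by simp
next
  case (2 u v ps w)
  then show ?case
    by (auto simp del: append.simps simp add: rev_proj_hom_wrap_iff doubleton_eq_iff)
qed

text \<open>Needed to show that only simple graphs are representable:
  \<open>graph_isomorphic\<close> by itself makes \<open>G\<close> merely well-formed, so
  finiteness, symmetry and absence of loops are pulled back from \<open>H\<close>.\<close>

lemma simple_graph_isomorphic:
  assumes "graph_isomorphic G H" and "simple_graph H"
  shows "simple_graph G"
proof -
  interpret H: pair_graph H using assms(2) by (simp add: simple_graph_def)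
  obtain h where h: "pre_digraph.digraph_isomorphism (with_proj G) h"
    and H: "with_proj H = app_iso h (with_proj G)"
    using assms(1) by (auto simp: graph_isomorphic_def digraph_iso_def)
  let ?f = "iso_verts h"
  have verts: "pverts H = ?f ` pverts G" and arcs: "parcs H = iso_arcs h ` parcs G"
    and ends: "iso_tail h = fst" "iso_head h = snd"
    using H by (auto simp: with_proj_def app_iso_def)
  have inj: "inj_on ?f (pverts G)" and "wf_digraph (with_proj G)"
    using h by (simp_all add: pre_digraph.digraph_isomorphism_def)
  then have wf: "u \<in> pverts G" "v \<in> pverts G" if "(u, v) \<in> parcs G" for u v
    using that by (auto simp: wf_digraph_def)
  \<comment> \<open>Arcs of \<open>H\<close> are pairs with \<open>fst\<close> and
    \<open>snd\<close> as end maps, so the vertex map determines the arc map.\<close>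
  have "iso_arcs h a = (?f (fst a), ?f (snd a))" if "a \<in> parcs G" for a
    using h that by (simp add: pre_digraph.digraph_isomorphism_def ends prod_eq_iff)
  then have arcs': "parcs H = (\<lambda>a. (?f (fst a), ?f (snd a))) ` parcs G"
    unfolding arcs by (intro image_cong) auto
  have fin: "finite (pverts G)"
    using inj verts H.pair_finite_verts by (metis finite_imageD)
  have fin_arcs: "finite (parcs G)"
    by (rule finite_subset[of _ "pverts G \<times> pverts G"]) (use wf fin in auto)
  have arc_image: "(?f u, ?f v) \<in> parcs H" if "(u, v) \<in> parcs G" for u v
    using imageI[OF that, of "\<lambda>a. (?f (fst a), ?f (snd a))"] by (simp add: arcs')
  have no_loop: "u \<noteq> v" if "(u, v) \<in> parcs G" for u v
    using arc_image[OF that] H.no_loops' by auto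
  have sym: "(v, u) \<in> parcs G" if uv: "(u, v) \<in> parcs G" for u v
  proof -
    have "(?f v, ?f u) \<in> parcs H"
      using arc_image[OF uv] H.arcs_symmetric by blast
    then obtain a b where ab: "(a, b) \<in> parcs G" "?f v = ?f a" "?f u = ?f b"
      by (auto simp: arcs')
    then have "v = a" "u = b"
      using inj wf[OF uv] wf[OF ab(1)] by (auto dest: inj_onD)
    then show ?thesis using ab by simp
  qed
  have "pair_graph G"
  proof (unfold_locales, goal_cases)
    case 6
    then show ?case
      using sym by (auto simp: symmetric_def sym_def arcs_ends_def arc_to_ends_def)
  qed (use wf fin fin_arcs no_loop in auto)
  then show ?thesis
    using assms(2) verts by (auto simp: simple_graph_def)
qed

lemma representable_palindromes:
  assumes "simple_graph G"
  shows "representable palindromes G"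
proof -
  interpret G: pair_graph G using assms by (simp add: simple_graph_def)
  let ?V = "pverts G"
  obtain xs where xs: "set xs = ?V"
    using G.pair_finite_verts finite_list by blast
  have "finite {(u, v). u \<in> ?V \<and> v \<in> ?V \<and> u \<noteq> v \<and> (u, v) \<notin> parcs G}"
    by (rule finite_subset[of _ "?V \<times> ?V"]) auto
  \<comment> \<open>This set contains each non-adjacent pair in both orders. The repeated wrapping
    is harmless, since any layer for a pair rules out a palindrome whatever it encloses.\<close>
  then obtain ps where ps: "set ps = {(u, v). u \<in> ?V \<and> v \<in> ?V \<and> u \<noteq> v \<and> (u, v) \<notin> parcs G}"
    using finite_list by blast
  \<comment> \<open>The core is a palindrome containing every vertex, so even vertices in no wrapped
    pair occur in \<open>w\<close>.\<close>
  define w where "w = wrap_pairs ps (xs @ rev xs)"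
  have set_w: "set w = ?V"
    unfolding w_def set_wrap_pairs using xs ps by auto
  have adj: "proj_hom a b w \<in> palindromes \<longleftrightarrow> (a, b) \<in> parcs G"
    if "a \<in> ?V" "b \<in> ?V" "a \<noteq> b" for a b
  proof -
    have "rev (proj_hom a b w) = proj_hom a b w \<longleftrightarrow> (a, b) \<notin> set ps \<and> (b, a) \<notin> set ps"
      unfolding w_def by (rule rev_proj_hom_wrap_pairs_iff) (use that ps in auto)
    moreover have "proj_hom a b w \<noteq> []"
      using that set_w by (simp add: proj_hom_eq_Nil_iff)
    ultimately show ?thesis
      using that ps G.arcs_symmetric by (auto simp: palindromes_def)
  qed
  obtain f :: "'a \<Rightarrow> nat" where inj: "inj_on f ?V"
    using finite_imp_inj_to_nat_seg[OF G.pair_finite_verts] by blast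
  let ?w = "map f w"
  have w_ne: "?w \<noteq> []"
    using assms set_w by (auto simp: simple_graph_def)
  have "graph_isomorphic G (word_graph palindromes ?w)"
    unfolding graph_isomorphic_iff[OF assms
        simple_graph_word_graph[OF exchange_closed_palindromes w_ne]]
  proof (intro exI conjI ballI)
    show "bij_betw f ?V (pverts (word_graph palindromes ?w))"
      using inj set_w by (simp add: word_graph_def bij_betw_def)
    fix u v assume uv: "u \<in> ?V" "v \<in> ?V"
    show "(u, v) \<in> parcs G \<longleftrightarrow> (f u, f v) \<in> parcs (word_graph palindromes ?w)"
    proof (cases "u = v")
      case True
      then show ?thesis using G.no_loops' by (auto simp: word_graph_def)
    next
      case False
      then have "f u \<noteq> f v" using inj uv by (auto dest: inj_onD)
      then show ?thesis
        using uv adj[OF uv False] proj_hom_map[OF inj _ uv, of w] set_w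
        by (auto simp: word_graph_def)
    qed
  qed
  then show ?thesis
    using w_ne unfolding representable_def by blast
qed

theorem mainTheorem9:
  shows "represented_class palindromes = {G :: 'a pair_pre_digraph. simple_graph G}"
  \<comment> \<open>The construction gives one inclusion. For the other, word graphs of
    \<open>palindromes\<close> are simple by closure under exchange, and simplicity passes back
    along the isomorphism.\<close>
  using representable_palindromes simple_graph_isomorphic
    simple_graph_word_graph[OF exchange_closed_palindromes]
  by (auto simp: represented_class_def representable_def)

end
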